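(* (Trace uncertainty relation.) Let $(M,\omega)$ be a symplectic manifold with a star product $*$ on $C^\infty(M)((\hbar^{\mathbb{Q}}))$, let $\rho:C^{\infty}(M)((\hbar^{\mathbb{Q}}))\to\mathbb{C}((\hbar^{\mathbb{Q}}))$ be a state, let $n\ge2$, and let $X_1,\dots,X_n\in C^{\infty}(M)((\hbar^{\mathbb{Q}}))$ satisfy $\overline{X_j}=X_j$ for $j=1,\dots,n$. Put $(\Delta X_j)^2:=\rho(X_j*X_j)-(\rho(X_j))^2$. Then, in the ordered field $\mathbb{R}((\hbar^{\mathbb{Q}}))$, $$(\Delta X_1)^2+\cdots+(\Delta X_n)^2\ \ge\ \frac{\hbar}{n-1}\sum_{1\le j<k\le n}\big|\rho(\{X_j,X_k\}_* )\big| ,$$ where $\{X_j,X_k\}_*:=\frac{1}{i\hbar}(X_j*X_k-X_k*X_j)$.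
   Context: For a field $\mathbb{K}$, $\mathbb{K}((\hbar^{\mathbb{Q}}))$ is the field of formal series $a=\sum_{q\in\mathbb{Q}}a_q\hbar^q$, $a_q\in\mathbb{K}$, whose support $\{q:a_q\neq0\}$ is well-ordered (every nonempty subset has a least element), with the usual addition and product. $\mathbb{R}((\hbar^{\mathbb{Q}}))$ is ordered by: $a>0$ iff $a\ne 0$ and $a_{q_0}>0$, where $q_0=\min\operatorname{supp}a$; $|a|=a$ if $a>0$ and $|a|=-a$ if $a\le0$. $\mathbb{C}((\hbar^{\mathbb{Q}}))=\mathbb{R}((\hbar^{\mathbb{Q}}))+i\,\mathbb{R}((\hbar^{\mathbb{Q}}))$. $C^\infty(M)((\hbar^{\mathbb{Q}}))$ is the $\mathbb{C}((\hbar^{\mathbb{Q}}))$-vector space of such series with coefficients in the complex-valued smooth functions on $M$. The overbar denotes coefficientwise complex conjugation ($\hbar$ is real). A star product is an associative $\mathbb{C}((\hbar^{\mathbb{Q}}))$-bilinear product of the form $f*g=\sum_{k=0}^\infty C_k(f,g)\hbar^k$, where the $C_k$ are bidifferential operators (acting coefficientwise) mapping $C^\infty(M)\times C^\infty(M)$ to $C^\infty(M)$, with $C_0(f,g)=fg$, $C_k(1,f)=C_k(f,1)=0$ for $k\ge1$, and $C_1(f,g)-C_1(g,f)=i\{f,g\}$, where $\{\cdot,\cdot\}$ is the Poisson bracket of $(M,\omega)$. A $\mathbb{C}((\hbar^{\mathbb{Q}}))$-linear functional $\rho:C^\infty(M)((\hbar^{\mathbb{Q}}))\to\mathbb{C}((\hbar^{\mathbb{Q}}))$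 is positive if $\rho(\overline f*f)\ge0$ (in particular lies in $\mathbb{R}((\hbar^{\mathbb{Q}}))$) for all $f$; it is a state if moreover $\rho(1)=1$. (For real $X_j,X_k$ one has $\rho(\{X_j,X_k\}_* )\in\mathbb{R}((\hbar^{\mathbb{Q}}))$.) *)

theory Defs
  imports "HOL-Analysis.Analysis" "HOL-Library.Function_Algebras"
begin

section \<open>Well-ordered subsets of a linear order\<close>

definition wo_set :: "'a::linorder set \<Rightarrow> bool" where
  "wo_set S \<longleftrightarrow> (\<forall>T\<subseteq>S. T \<noteq> {} \<longrightarrow> (\<exists>m\<in>T. \<forall>t\<in>T. m \<le> t))"

lemma wo_setE:
  assumes "wo_set S" "T \<subseteq> S" "T \<noteq> {}"
  obtains m where "m \<in> T" "\<And>t. t \<in> T \<Longrightarrow> m \<le> t"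
proof -
  have "\<exists>m\<in>T. \<forall>t\<in>T. m \<le> t"
    using assms(2,3) assms(1)[unfolded wo_set_def, THEN spec, of T] by simp
  then show thesis using that by auto
qed

lemma wo_set_subset: "wo_set S \<Longrightarrow> T \<subseteq> S \<Longrightarrow> wo_set T"
  unfolding wo_set_def by blast

lemma wo_set_empty [simp]: "wo_set {}"
  unfolding wo_set_def by blast

lemma wo_set_finite: "finite S \<Longrightarrow> wo_set S"
  unfolding wo_set_def by (metis Min_in Min_le finite_subset)

lemma wo_set_no_desc:
  assumes "wo_set S" "\<And>n. f n \<in> S" "\<And>n. f (Suc n) < f n"
  shows False
proof -
  obtain m where m: "m \<in> range f" "\<And>t. t \<in> range f \<Longrightarrow> m \<le> t"
    by (rule wo_setE[OF assms(1), of "range f"]) (use assms(2) in auto)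
  then obtain n where "m = f n" by auto
  then show False using m(2)[of "f (Suc n)"] assms(3)[of n] by simp
qed

lemma wo_setI_desc:
  assumes "\<And>f::nat \<Rightarrow> 'a::linorder. (\<And>n. f n \<in> S) \<Longrightarrow> (\<And>n. f (Suc n) < f n) \<Longrightarrow> False"
  shows "wo_set S"
proof (rule ccontr)
  assume "\<not> wo_set S"
  then obtain T where T: "T \<subseteq> S" "T \<noteq> {}" "\<forall>m\<in>T. \<exists>t\<in>T. t < m"
    unfolding wo_set_def by (meson not_le)
  have "\<exists>f. \<forall>n::nat. f n \<in> T \<and> f (Suc n) < f n"
    by (rule dependent_nat_choice) (use T in auto)
  then obtain f where "\<And>n::nat. f n \<in> T" "\<And>n. f (Suc n) < f n" by blast
  then show False using assms[of f] T(1) by blast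
qed

lemma wo_set_incseq_subseq:
  assumes "wo_set S" "\<And>n::nat. f n \<in> S"
  obtains r where "strict_mono r" "incseq (\<lambda>n. f (r n))"
proof -
  obtain r where r: "strict_mono r" "monoseq (\<lambda>n. f (r n))"
    using seq_monosub[of f] by blast
  show thesis
  proof (cases "incseq (\<lambda>n. f (r n))")
    case True
    then show ?thesis using that r(1) by blast
  next
    case False
    then have dec: "decseq (\<lambda>n. f (r n))"
      using r(2) by (auto simp: monoseq_iff)
    obtain m where "m \<in> range (\<lambda>n. f (r n))" "\<And>t. t \<in> range (\<lambda>n. f (r n)) \<Longrightarrow> m \<le> t"
      by (rule wo_setE[OF assms(1), of "range (\<lambda>n. f (r n))"]) (use assms(2) in auto)
    then obtain N where N: "\<And>n. f (r N) \<le> f (r n)" by auto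
    have const: "f (r (n + N)) = f (r N)" for n
      using N[of "n + N"] decseqD[OF dec, of N "n + N"] by simp
    have "strict_mono (\<lambda>n. r (n + N))"
      using r(1) by (auto simp: strict_mono_def)
    moreover have "incseq (\<lambda>n. f (r (n + N)))"
      by (simp add: const)
    ultimately show ?thesis using that[of "\<lambda>n. r (n + N)"] by simp
  qed
qed

lemma wo_set_Un:
  assumes "wo_set S" "wo_set T" shows "wo_set (S \<union> T)"
  unfolding wo_set_def
proof (intro allI impI)
  fix U assume U: "U \<subseteq> S \<union> T" "U \<noteq> {}"
  show "\<exists>m\<in>U. \<forall>t\<in>U. m \<le> t"
  proof (cases "U \<inter> S = {} \<or> U \<inter> T = {}")
    case True
    then have "U \<subseteq> S \<or> U \<subseteq> T" using U by auto
    then obtain m where "m \<in> U" "\<And>t. t \<in> U \<Longrightarrow> m \<le> t"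
      by (elim disjE) (rule wo_setE[OF assms(1) _ U(2)] wo_setE[OF assms(2) _ U(2)]; auto)+
    then show ?thesis by auto
  next
    case False
    obtain m where m: "m \<in> U \<inter> S" "\<And>t. t \<in> U \<inter> S \<Longrightarrow> m \<le> t"
      by (rule wo_setE[OF assms(1), of "U \<inter> S"]) (use False in auto)
    obtain n where n: "n \<in> U \<inter> T" "\<And>t. t \<in> U \<inter> T \<Longrightarrow> n \<le> t"
      by (rule wo_setE[OF assms(2), of "U \<inter> T"]) (use False in auto)
    have "\<forall>t\<in>U. min m n \<le> t"
    proof
      fix t assume "t \<in> U"
      then have "t \<in> U \<inter> S \<or> t \<in> U \<inter> T" using U(1) by auto
      then show "min m n \<le> t"
        using m(2)[of t] n(2)[of t] by (auto simp: min_le_iff_disj)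
    qed
    moreover have "min m n \<in> U" using m(1) n(1) by (simp add: min_def)
    ultimately show ?thesis by auto
  qed
qed

lemma wo_set_UN:
  "finite I \<Longrightarrow> (\<And>i. i \<in> I \<Longrightarrow> wo_set (S i)) \<Longrightarrow> wo_set (\<Union>i\<in>I. S i)"
  by (induction I rule: finite_induct) (auto intro: wo_set_Un)

lemma wo_set_local:
  assumes "\<And>q. wo_set (S \<inter> {..q})" shows "wo_set S"
  unfolding wo_set_def
proof (intro allI impI)
  fix U assume U: "U \<subseteq> S" "U \<noteq> {}"
  then obtain q where q: "q \<in> U" by auto
  obtain m where m: "m \<in> U \<inter> {..q}" "\<And>t. t \<in> U \<inter> {..q} \<Longrightarrow> m \<le> t"
    by (rule wo_setE[OF assms[of q], of "U \<inter> {..q}"]) (use U q in auto)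
  have "\<forall>t\<in>U. m \<le> t"
  proof
    fix t assume "t \<in> U"
    then show "m \<le> t" using m by (cases "t \<le> q") auto
  qed
  then show "\<exists>m\<in>U. \<forall>t\<in>U. m \<le> t" using m(1) by auto
qed

lemma wo_set_sum:
  fixes S T :: "rat set"
  assumes "wo_set S" "wo_set T"
  shows "wo_set {s + t | s t. s \<in> S \<and> t \<in> T}"
proof (rule wo_setI_desc)
  fix f :: "nat \<Rightarrow> rat"
  assume f: "\<And>n. f n \<in> {s + t | s t. s \<in> S \<and> t \<in> T}" and dec: "\<And>n. f (Suc n) < f n"
  have "\<exists>p. fst p \<in> S \<and> snd p \<in> T \<and> f n = fst p + snd p" for n using f[of n] by auto
  then have "\<exists>p. \<forall>n. fst (p n) \<in> S \<and> snd (p n) \<in> T \<and> f n = fst (p n) + snd (p n)"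
    by (intro choice) simp
  then obtain p where p: "\<And>n. fst (p n) \<in> S \<and> snd (p n) \<in> T \<and> f n = fst (p n) + snd (p n)"
    by auto
  define s where "s n = fst (p n)" for n
  define t where "t n = snd (p n)" for n
  have st: "s n \<in> S" "t n \<in> T" "f n = s n + t n" for n
    using p[of n] by (simp_all add: s_def t_def)
  obtain r where r: "strict_mono r" "incseq (\<lambda>n. s (r n))"
    by (rule wo_set_incseq_subseq[of S s]) (use assms(1) st(1) in auto)
  show False
  proof (rule wo_set_no_desc[OF assms(2), of "\<lambda>n. t (r n)"])
    show "t (r n) \<in> T" for n by (rule st)
    fix n
    have anti: "f l < f k" if "k < l" for k l
      using that
    proof (induction rule: less_Suc_induct)
      case (1 i)
      show ?case by (rule dec)
    next
      case (2 i j k)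
      show ?case by (rule less_trans[OF 2(4) 2(3)])
    qed
    have "f (r (Suc n)) < f (r n)"
      by (rule anti) (use r(1) in \<open>simp add: strict_mono_def\<close>)
    moreover have "s (r n) \<le> s (r (Suc n))" using incseq_SucD[OF r(2), of n] by simp
    ultimately show "t (r (Suc n)) < t (r n)"
      unfolding st(3) by linarith
  qed
qed

lemma finite_sum_decomp:
  fixes S T :: "rat set"
  assumes "wo_set S" "wo_set T"
  shows "finite {(s, t). s \<in> S \<and> t \<in> T \<and> s + t = q}"
proof (rule ccontr)
  let ?P = "{(s, t). s \<in> S \<and> t \<in> T \<and> s + t = q}"
  assume "infinite ?P"
  then obtain f :: "nat \<Rightarrow> rat \<times> rat" where f: "inj f" "range f \<subseteq> ?P"
    using infinite_countable_subset by blast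
  define s where "s n = fst (f n)" for n
  define t where "t n = snd (f n)" for n
  have st: "s n \<in> S" "t n \<in> T" "s n + t n = q" for n
    using subsetD[OF f(2), of "f n"] unfolding s_def t_def by (auto simp: case_prod_beta)
  have inj: "m = n" if "s m = s n" for m n
  proof -
    have "t m = t n" using st(3)[of m] st(3)[of n] that by auto
    then have "f m = f n" using that unfolding s_def t_def by (simp add: prod_eq_iff)
    then show ?thesis using f(1) by (simp add: inj_eq)
  qed
  obtain r where r: "strict_mono r" "incseq (\<lambda>n. s (r n))"
    by (rule wo_set_incseq_subseq[of S s]) (use assms(1) st(1) in auto)
  show False
  proof (rule wo_set_no_desc[OF assms(2), of "\<lambda>n. t (r n)"])
    show "t (r n) \<in> T" for n by (rule st)
    fix n
    have "s (r n) \<le> s (r (Suc n))" using incseq_SucD[OF r(2), of n] by simp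
    moreover have "s (r n) \<noteq> s (r (Suc n))"
      using inj[of "r n" "r (Suc n)"] strict_monoD[OF r(1), of n "Suc n"] by auto
    ultimately have "s (r n) < s (r (Suc n))" by simp
    then show "t (r (Suc n)) < t (r n)"
      using st(3)[of "r n"] st(3)[of "r (Suc n)"] by linarith
  qed
qed


section \<open>Hahn series in \<open>\<hbar>\<close> with rational exponents\<close>

typedef (overloaded) 'a hahn = "{a :: rat \<Rightarrow> 'a::zero. wo_set {q. a q \<noteq> 0}}"
  morphisms hcoeff Hahn
  by (rule exI[of _ "\<lambda>_. 0"]) simp

definition hsupp :: "'a::zero hahn \<Rightarrow> rat set" where
  "hsupp a = {q. hcoeff a q \<noteq> 0}"

lemma wo_hsupp [simp]: "wo_set (hsupp a)"
  using hcoeff[of a] by (simp add: hsupp_def)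

lemma hcoeff_Hahn: "wo_set {q. f q \<noteq> 0} \<Longrightarrow> hcoeff (Hahn f) = f"
  by (rule Hahn_inverse) simp

lemma hahn_eqI: "(\<And>q. hcoeff a q = hcoeff b q) \<Longrightarrow> a = b"
  by (simp add: hcoeff_inject[symmetric] fun_eq_iff)

lemma hahn_eq_iff: "a = b \<longleftrightarrow> (\<forall>q. hcoeff a q = hcoeff b q)"
  using hahn_eqI by blast

lemma wo_set_supp2:
  assumes "\<And>q. hcoeff a q = 0 \<Longrightarrow> hcoeff b q = 0 \<Longrightarrow> f q = 0"
  shows "wo_set {q. f q \<noteq> 0}"
  by (rule wo_set_subset[OF wo_set_Un[OF wo_hsupp[of a] wo_hsupp[of b]]])
    (use assms in \<open>auto simp: hsupp_def\<close>)

text \<open>\<open>hmonom r c\<close> is the monomial \<open>c \<hbar>\<^sup>r\<close>.\<close>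

definition hmonom :: "rat \<Rightarrow> 'a::zero \<Rightarrow> 'a hahn" where
  "hmonom r c = Hahn (\<lambda>q. if q = r then c else 0)"

lemma hcoeff_hmonom: "hcoeff (hmonom r c) q = (if q = r then c else 0)"
  unfolding hmonom_def
  by (subst hcoeff_Hahn) (auto intro: wo_set_subset[OF wo_set_finite[of "{r}"]])

abbreviation hconst :: "'a::zero \<Rightarrow> 'a hahn" where
  "hconst \<equiv> hmonom 0"

abbreviation hbar :: "'a::zero_neq_one hahn" where
  "hbar \<equiv> hmonom 1 1"

text \<open>Coefficientwise application of a map; only used for maps sending \<open>0\<close> to \<open>0\<close>.\<close>

definition hmap :: "('a::zero \<Rightarrow> 'b::zero) \<Rightarrow> 'a hahn \<Rightarrow> 'b hahn" where
  "hmap f a = Hahn (\<lambda>q. f (hcoeff a q))"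

lemma hcoeff_hmap: "f 0 = 0 \<Longrightarrow> hcoeff (hmap f a) q = f (hcoeff a q)"
  unfolding hmap_def by (subst hcoeff_Hahn) (auto intro: wo_set_supp2[of a a])

text \<open>Coefficientwise extension of a (biadditive) map:
  \<open>(\<Sum> a\<^sub>s \<hbar>\<^sup>s, \<Sum> b\<^sub>t \<hbar>\<^sup>t) \<mapsto> \<Sum> m(a\<^sub>s, b\<^sub>t) \<hbar>\<^bsup>s+t\<^esup>\<close>.\<close>

definition hpairs :: "'a::zero hahn \<Rightarrow> 'b::zero hahn \<Rightarrow> rat \<Rightarrow> (rat \<times> rat) set" where
  "hpairs a b q = {(s, t). s \<in> hsupp a \<and> t \<in> hsupp b \<and> s + t = q}"

definition hconv :: "('a \<Rightarrow> 'b \<Rightarrow> 'c) \<Rightarrow> 'a::zero hahn \<Rightarrow> 'b::zero hahn \<Rightarrow> 'c::comm_monoid_add hahn" where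
  "hconv m a b = Hahn (\<lambda>q. \<Sum>(s, t)\<in>hpairs a b q. m (hcoeff a s) (hcoeff b t))"

lemma finite_hpairs [simp]: "finite (hpairs a b q)"
  unfolding hpairs_def by (rule finite_sum_decomp) simp_all

lemma hcoeff_hconv:
  "hcoeff (hconv m a b) q = (\<Sum>(s, t)\<in>hpairs a b q. m (hcoeff a s) (hcoeff b t))"
proof -
  have "{q. (\<Sum>(s, t)\<in>hpairs a b q. m (hcoeff a s) (hcoeff b t)) \<noteq> 0}
      \<subseteq> {s + t | s t. s \<in> hsupp a \<and> t \<in> hsupp b}"
  proof
    fix q assume "q \<in> {q. (\<Sum>(s, t)\<in>hpairs a b q. m (hcoeff a s) (hcoeff b t)) \<noteq> 0}"
    then have "hpairs a b q \<noteq> {}" by auto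
    then show "q \<in> {s + t | s t. s \<in> hsupp a \<and> t \<in> hsupp b}"
      unfolding hpairs_def by blast
  qed
  then show ?thesis
    unfolding hconv_def
    by (subst hcoeff_Hahn) (auto intro: wo_set_subset[OF wo_set_sum[OF wo_hsupp[of a] wo_hsupp[of b]]])
qed

lemma hcoeff_hconv_superset:
  assumes "\<And>y. m 0 y = 0" "\<And>x. m x 0 = 0"
    and "wo_set S" "wo_set T" "hsupp a \<subseteq> S" "hsupp b \<subseteq> T"
  shows "hcoeff (hconv m a b) q
    = (\<Sum>(s, t)\<in>{(s, t). s \<in> S \<and> t \<in> T \<and> s + t = q}. m (hcoeff a s) (hcoeff b t))"
  unfolding hcoeff_hconv
proof (rule sum.mono_neutral_left)
  show "finite {(s, t). s \<in> S \<and> t \<in> T \<and> s + t = q}"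
    by (rule finite_sum_decomp) fact+
  show "hpairs a b q \<subseteq> {(s, t). s \<in> S \<and> t \<in> T \<and> s + t = q}"
    using assms(5,6) by (auto simp: hpairs_def)
  show "\<forall>i\<in>{(s, t). s \<in> S \<and> t \<in> T \<and> s + t = q} - hpairs a b q.
      (case i of (s, t) \<Rightarrow> m (hcoeff a s) (hcoeff b t)) = 0"
    by (auto simp: hpairs_def hsupp_def assms(1,2))
qed

lemma hsupp_hconv: "hsupp (hconv m a b) \<subseteq> {s + t | s t. s \<in> hsupp a \<and> t \<in> hsupp b}"
proof
  fix q assume "q \<in> hsupp (hconv m a b)"
  then have "hpairs a b q \<noteq> {}" by (auto simp: hsupp_def hcoeff_hconv)
  then show "q \<in> {s + t | s t. s \<in> hsupp a \<and> t \<in> hsupp b}"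
    unfolding hpairs_def by blast
qed

subsection \<open>Additive group\<close>

instantiation hahn :: (zero) zero
begin
definition "0 = Hahn (\<lambda>_. 0)"
instance ..
end

lemma hcoeff_0 [simp]: "hcoeff 0 q = 0"
  unfolding zero_hahn_def by (subst hcoeff_Hahn) simp_all

lemma hahn_nonzero: "a \<noteq> 0 \<longleftrightarrow> (\<exists>q. hcoeff a q \<noteq> 0)"
  by (auto simp: hahn_eq_iff)

instantiation hahn :: (comm_monoid_add) comm_monoid_add
begin

definition "a + b = Hahn (\<lambda>q. hcoeff a q + hcoeff b q)"

lemma hcoeff_add [simp]: "hcoeff (a + b) q = hcoeff a q + hcoeff b q"
  unfolding plus_hahn_def by (subst hcoeff_Hahn) (auto intro: wo_set_supp2[of a b])

instance by standard (auto simp: hahn_eq_iff add_ac)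

end

instantiation hahn :: (ab_group_add) ab_group_add
begin

definition "- a = Hahn (\<lambda>q. - hcoeff a q)"
definition "a - b = Hahn (\<lambda>q. hcoeff a q - hcoeff b q)"

lemma hcoeff_uminus [simp]: "hcoeff (- a) q = - hcoeff a q"
  unfolding uminus_hahn_def by (subst hcoeff_Hahn) (auto intro: wo_set_supp2[of a a])

lemma hcoeff_diff [simp]: "hcoeff (a - b) q = hcoeff a q - hcoeff b q"
  unfolding minus_hahn_def by (subst hcoeff_Hahn) (rule wo_set_supp2[of a b], auto)

instance by standard (auto simp: hahn_eq_iff)

end

lemma hcoeff_sum: "hcoeff (sum f I) q = (\<Sum>i\<in>I. hcoeff (f i) q)"
  by (induction I rule: infinite_finite_induct) auto

subsection \<open>Multiplication\<close>

instantiation hahn :: (semiring_0) times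
begin
definition "a * b = hconv (*) a b"
instance ..
end

lemma hcoeff_mult_superset:
  fixes a b :: "'a::semiring_0 hahn"
  assumes "wo_set S" "wo_set T" "hsupp a \<subseteq> S" "hsupp b \<subseteq> T"
  shows "hcoeff (a * b) q
    = (\<Sum>(s, t)\<in>{(s, t). s \<in> S \<and> t \<in> T \<and> s + t = q}. hcoeff a s * hcoeff b t)"
  unfolding times_hahn_def by (rule hcoeff_hconv_superset) (use assms in auto)

lemma hsupp_mult: "hsupp (a * b) \<subseteq> {s + t | s t. s \<in> hsupp a \<and> t \<in> hsupp b}"
  for a b :: "'a::semiring_0 hahn"
  unfolding times_hahn_def by (rule hsupp_hconv)

lemma hcoeff_hmonom_mult: "hcoeff (hmonom r c * a) q = c * hcoeff a (q - r)"
  for a :: "'a::semiring_0 hahn"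
proof -
  have "hcoeff (hmonom r c * a) q
    = (\<Sum>(s, t)\<in>{(s, t). s \<in> {r} \<and> t \<in> insert (q - r) (hsupp a) \<and> s + t = q}. hcoeff (hmonom r c) s * hcoeff a t)"
  proof (rule hcoeff_mult_superset)
    show "wo_set {r}" by (simp add: wo_set_finite)
    show "wo_set (insert (q - r) (hsupp a))"
      using wo_set_Un[of "{q - r}" "hsupp a"] by (simp add: wo_set_finite)
  qed (auto simp: hsupp_def hcoeff_hmonom split: if_splits)
  also have "{(s, t). s \<in> {r} \<and> t \<in> insert (q - r) (hsupp a) \<and> s + t = q} = {(r, q - r)}"
    by auto
  finally show ?thesis by (simp add: hcoeff_hmonom)
qed

instance hahn :: (comm_ring) comm_ring
proof
  fix a b c :: "'a hahn"
  have swap: "hpairs b a q = prod.swap ` hpairs a b q" for q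
    by (force simp: hpairs_def)
  show "a * b = b * a"
    by (rule hahn_eqI)
      (simp add: times_hahn_def hcoeff_hconv swap sum.reindex case_prod_beta mult.commute)
  let ?A = "hsupp a" and ?B = "hsupp b" and ?C = "hsupp c"
  show "a * b * c = a * (b * c)"
  proof (rule hahn_eqI)
    fix q
    define sumset where "sumset S T = {s + t | s t. s \<in> S \<and> t \<in> T}" for S T :: "rat set"
    let ?AB = "sumset ?A ?B" and ?BC = "sumset ?B ?C"
    define P where "P S T p = {(s, t). s \<in> S \<and> t \<in> T \<and> s + t = p}" for S T and p :: rat
    define f where "f s t u = hcoeff a s * hcoeff b t * hcoeff c u" for s t u
    have P: "(s, t) \<in> P S T p \<longleftrightarrow> s \<in> S \<and> t \<in> T \<and> s + t = p" for s t S T p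
      by (simp add: P_def)
    have AB: "s + t \<in> ?AB" if "s \<in> ?A" "t \<in> ?B" for s t using that by (auto simp: sumset_def)
    have BC: "s + t \<in> ?BC" if "s \<in> ?B" "t \<in> ?C" for s t using that by (auto simp: sumset_def)
    have wo: "wo_set ?AB" "wo_set ?BC" by (simp_all add: wo_set_sum sumset_def)
    have fin: "finite (P S T p)" if "wo_set S" "wo_set T" for S T p
      unfolding P_def using finite_sum_decomp[OF that] .
    note mult = hcoeff_mult_superset[folded P_def]
    have "hcoeff (a * b * c) q = (\<Sum>(p, u)\<in>P ?AB ?C q. hcoeff (a * b) p * hcoeff c u)"
      by (rule mult[OF wo(1) wo_hsupp hsupp_mult[folded sumset_def] subset_refl])
    also have "\<dots> = (\<Sum>x\<in>P ?AB ?C q. \<Sum>y\<in>P ?A ?B (fst x). f (fst y) (snd y) (snd x))"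
      by (rule sum.cong)
        (simp_all add: mult[of ?A ?B] sum_distrib_right case_prod_beta f_def)
    also have "\<dots> = (\<Sum>(x, y)\<in>(SIGMA x:P ?AB ?C q. P ?A ?B (fst x)). f (fst y) (snd y) (snd x))"
      by (rule sum.Sigma) (simp_all add: fin wo)
    also have "\<dots> = (\<Sum>(x, y)\<in>(SIGMA x:P ?A ?BC q. P ?B ?C (snd x)). f (fst x) (fst y) (snd y))"
      by (rule sum.reindex_bij_witness[where
            i = "\<lambda>((s, w), (t, u)). ((s + t, u), (s, t))" and
            j = "\<lambda>((p, u), (s, t)). ((s, t + u), (t, u))"]) (auto simp: P AB BC add.assoc)
    also have "\<dots> = (\<Sum>x\<in>P ?A ?BC q. \<Sum>y\<in>P ?B ?C (snd x). f (fst x) (fst y) (snd y))"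
      by (rule sum.Sigma[symmetric]) (simp_all add: fin wo)
    also have "\<dots> = (\<Sum>(s, w)\<in>P ?A ?BC q. hcoeff a s * hcoeff (b * c) w)"
      by (rule sum.cong)
        (simp_all add: mult[of ?B ?C] sum_distrib_left case_prod_beta mult.assoc f_def)
    also have "\<dots> = hcoeff (a * (b * c)) q"
      by (rule mult[OF wo_hsupp wo(2) subset_refl hsupp_mult[folded sumset_def], symmetric])
    finally show "hcoeff (a * b * c) q = hcoeff (a * (b * c)) q" .
  qed
  show "(a + b) * c = a * c + b * c"
  proof (rule hahn_eqI)
    fix q
    have wo: "wo_set (?A \<union> ?B)" by (simp add: wo_set_Un)
    have sup: "hsupp (a + b) \<subseteq> ?A \<union> ?B" by (auto simp: hsupp_def)
    show "hcoeff ((a + b) * c) q = hcoeff (a * c + b * c) q"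
      using wo sup
      by (simp add: hcoeff_mult_superset[of "?A \<union> ?B" ?C] distrib_right sum.distrib case_prod_beta)
  qed
qed

instantiation hahn :: (comm_ring_1) comm_ring_1
begin

definition "1 = hconst 1"

instance
proof
  fix a :: "'a hahn"
  show "1 * a = a"
    by (rule hahn_eqI) (simp add: one_hahn_def hcoeff_hmonom_mult)
  show "(0 :: 'a hahn) \<noteq> 1"
    by (auto simp: one_hahn_def hahn_eq_iff hcoeff_hmonom)
qed

end

lemma hcoeff_1: "hcoeff 1 q = (if q = 0 then 1 else 0)"
  by (simp add: one_hahn_def hcoeff_hmonom)

lemma hmonom_mult_hmonom: "hmonom r c * hmonom s d = hmonom (r + s) (c * d)"
  for c d :: "'a::semiring_0"
  by (rule hahn_eqI) (auto simp: hcoeff_hmonom_mult hcoeff_hmonom)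

subsection \<open>The lowest exponent\<close>

definition hord :: "'a::zero hahn \<Rightarrow> rat" where
  "hord a = (LEAST q. hcoeff a q \<noteq> 0)"

lemma hord:
  assumes "a \<noteq> 0"
  shows hcoeff_hord: "hcoeff a (hord a) \<noteq> 0" and hord_le: "\<And>q. hcoeff a q \<noteq> 0 \<Longrightarrow> hord a \<le> q"
proof -
  have "hsupp a \<noteq> {}" using assms by (auto simp: hahn_nonzero hsupp_def)
  then obtain m where "m \<in> hsupp a" "\<And>t. t \<in> hsupp a \<Longrightarrow> m \<le> t"
    by (rule wo_setE[OF wo_hsupp[of a] subset_refl]) auto
  then have m: "hcoeff a m \<noteq> 0" "\<And>t. hcoeff a t \<noteq> 0 \<Longrightarrow> m \<le> t" by (auto simp: hsupp_def)
  then have "hord a = m" unfolding hord_def by (intro Least_equality) auto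
  then show "hcoeff a (hord a) \<noteq> 0" "\<And>q. hcoeff a q \<noteq> 0 \<Longrightarrow> hord a \<le> q"
    using m by auto
qed

lemma hordI:
  assumes "hcoeff a q \<noteq> 0" "\<And>t. t < q \<Longrightarrow> hcoeff a t = 0"
  shows "hord a = q"
  unfolding hord_def using assms by (intro Least_equality) (auto intro: leI)

lemma hcoeff_mult_below:
  fixes a b :: "'a::semiring_0 hahn"
  assumes "\<And>s. s < x \<Longrightarrow> hcoeff a s = 0" "\<And>t. t < y \<Longrightarrow> hcoeff b t = 0" "q < x + y"
  shows "hcoeff (a * b) q = 0"
proof (rule ccontr)
  assume "hcoeff (a * b) q \<noteq> 0"
  then obtain s t where "s \<in> hsupp a" "t \<in> hsupp b" "q = s + t"
    using hsupp_mult[of a b] by (auto simp: hsupp_def)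
  then show False using assms
    by (metis (mono_tags) add_mono hsupp_def leD leI mem_Collect_eq)
qed

lemma hcoeff_mult_lowest:
  fixes a b :: "'a::semiring_0 hahn"
  assumes "\<And>s. s < x \<Longrightarrow> hcoeff a s = 0" "\<And>t. t < y \<Longrightarrow> hcoeff b t = 0"
  shows "hcoeff (a * b) (x + y) = hcoeff a x * hcoeff b y"
proof -
  have sub: "hpairs a b (x + y) \<subseteq> {(x, y)}"
  proof
    fix z assume "z \<in> hpairs a b (x + y)"
    then obtain s t where z: "z = (s, t)" "hcoeff a s \<noteq> 0" "hcoeff b t \<noteq> 0" "s + t = x + y"
      by (auto simp: hpairs_def hsupp_def)
    then have "x \<le> s" "y \<le> t" using assms by (meson not_le)+
    then show "z \<in> {(x, y)}" using z by auto
  qed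
  have "hcoeff (a * b) (x + y) = (\<Sum>(s, t)\<in>hpairs a b (x + y). hcoeff a s * hcoeff b t)"
    by (simp add: times_hahn_def hcoeff_hconv)
  also have "\<dots> = (\<Sum>(s, t)\<in>{(x, y)}. hcoeff a s * hcoeff b t)"
    by (rule sum.mono_neutral_left) (use sub in \<open>auto simp: hpairs_def hsupp_def\<close>)
  finally show ?thesis by simp
qed

subsection \<open>Field structure\<close>

lemma hahn_one_minus_inverse:
  fixes e :: "'a::comm_ring_1 hahn"
  assumes pos: "\<And>q. q \<le> 0 \<Longrightarrow> hcoeff e q = 0"
  shows "\<exists>b. (1 - e) * b = 1"
proof (cases "e = 0")
  case True
  then show ?thesis by (intro exI[of _ 1]) simp
next
  case False
  define d where "d = hord e"
  have d: "d > 0" using hcoeff_hord[OF False] pos unfolding d_def by (meson not_le)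
  have below: "hcoeff e q = 0" if "q < d" for q
    using hord_le[OF False, of q] that unfolding d_def by (meson leD)
  have pow: "hcoeff (e ^ n) q = 0" if "q < of_nat n * d" for n q
    using that
  proof (induction n arbitrary: q)
    case 0
    then show ?case by (simp add: hcoeff_1)
  next
    case (Suc n)
    show ?case unfolding power_Suc
      by (rule hcoeff_mult_below[of d _ "of_nat n * d"])
        (use below Suc in \<open>auto simp: algebra_simps\<close>)
  qed
  define f where "f q = (\<Sum>n\<in>{n. of_nat n * d \<le> q}. hcoeff (e ^ n) q)" for q
  have bnd: "\<exists>N. q < of_nat N * d" for q :: rat
    using d ex_less_of_nat_mult by blast
  have sub: "{n. of_nat n * d \<le> q} \<subseteq> {..<N}" if "q < of_nat N * d" for q N
  proof
    fix n assume "n \<in> {n. of_nat n * d \<le> q}"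
    then have "of_nat n * d < of_nat N * d" using that by auto
    then show "n \<in> {..<N}" using d by auto
  qed
  have f_eq: "f q = (\<Sum>n<N. hcoeff (e ^ n) q)" if "q < of_nat N * d" for q N
    unfolding f_def
    by (rule sum.mono_neutral_left) (use sub[OF that] in \<open>auto intro!: pow\<close>)
  have "wo_set {q. f q \<noteq> 0}"
  proof (rule wo_set_local)
    fix q
    obtain N where N: "q < of_nat N * d" using bnd by blast
    have "{q. f q \<noteq> 0} \<inter> {..q} \<subseteq> (\<Union>n\<in>{..<N}. hsupp (e ^ n))"
    proof
      fix t assume t: "t \<in> {q. f q \<noteq> 0} \<inter> {..q}"
      then have "f t = (\<Sum>n<N. hcoeff (e ^ n) t)" using N by (intro f_eq) auto
      then obtain n where "n < N" "hcoeff (e ^ n) t \<noteq> 0"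
        using t by (auto elim: sum.not_neutral_contains_not_neutral)
      then show "t \<in> (\<Union>n\<in>{..<N}. hsupp (e ^ n))" by (auto simp: hsupp_def)
    qed
    then show "wo_set ({q. f q \<noteq> 0} \<inter> {..q})"
      by (rule wo_set_subset[rotated]) (rule wo_set_UN, auto)
  qed
  then have cf: "hcoeff (Hahn f) = f" by (rule hcoeff_Hahn)
  have "(1 - e) * Hahn f = 1"
  proof (rule hahn_eqI)
    fix q
    obtain N where N: "q < of_nat N * d" using bnd by blast
    define g where "g = (\<Sum>n<N. e ^ n)"
    have geo: "(1 - e) * g = 1 - e ^ N"
      unfolding g_def by (simp add: one_diff_power_eq)
    have "hcoeff ((1 - e) * (Hahn f - g)) q = 0"
    proof (rule hcoeff_mult_below[of 0 _ "of_nat N * d"])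
      show "hcoeff (1 - e) s = 0" if "s < 0" for s
        using that pos by (simp add: hcoeff_1)
      show "hcoeff (Hahn f - g) t = 0" if "t < of_nat N * d" for t
        using f_eq[OF that] by (simp add: cf g_def hcoeff_sum)
    qed (use N in simp)
    then have "hcoeff ((1 - e) * Hahn f) q = hcoeff ((1 - e) * g) q"
      by (simp add: right_diff_distrib del: left_diff_distrib')
    also have "\<dots> = hcoeff 1 q" using pow[OF N] by (simp add: geo)
    finally show "hcoeff ((1 - e) * Hahn f) q = hcoeff 1 q" .
  qed
  then show ?thesis by blast
qed

lemma hahn_inverse_exists:
  fixes a :: "'a::field hahn"
  assumes "a \<noteq> 0"
  shows "\<exists>b. a * b = 1"
proof -
  define r where "r = hord a"
  define c where "c = hcoeff a r"
  have c: "c \<noteq> 0" using hcoeff_hord[OF assms] by (simp add: c_def r_def)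
  define m where "m = hmonom (- r) (inverse c)"
  define e where "e = 1 - m * a"
  have "hcoeff e q = 0" if "q \<le> 0" for q
  proof (cases "q = 0")
    case True
    then show ?thesis using c by (simp add: e_def m_def hcoeff_hmonom_mult hcoeff_1 c_def)
  next
    case False
    then have "q + r < r" using that by simp
    then have "hcoeff a (q + r) = 0" using hord_le[OF assms] unfolding r_def by (meson leD)
    then show ?thesis using False by (simp add: e_def m_def hcoeff_hmonom_mult hcoeff_1)
  qed
  then obtain b where "(1 - e) * b = 1" using hahn_one_minus_inverse by blast
  then have "a * (m * b) = 1" by (simp add: e_def ac_simps)
  then show ?thesis by blast
qed

instantiation hahn :: (field) field
begin

definition "inverse a = (if a = 0 then 0 else (SOME b. a * b = (1 :: 'a hahn)))"
definition "a div b = a * inverse (b :: 'a hahn)"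

instance
proof
  fix a b :: "'a hahn"
  show "inverse a * a = 1" if "a \<noteq> 0"
    using someI_ex[OF hahn_inverse_exists[OF that]] that
    by (simp add: inverse_hahn_def mult.commute)
  show "a div b = a * inverse b" by (rule divide_hahn_def)
  show "inverse (0 :: 'a hahn) = 0" by (simp add: inverse_hahn_def)
qed

end

subsection \<open>Order\<close>

definition hpos :: "'a::{zero,ord} hahn \<Rightarrow> bool" where
  "hpos a \<longleftrightarrow> a \<noteq> 0 \<and> hcoeff a (hord a) > 0"

lemma hposI:
  "hcoeff a q > 0 \<Longrightarrow> (\<And>t. t < q \<Longrightarrow> hcoeff a t = 0) \<Longrightarrow> hpos a"
  for a :: "'a::linordered_field hahn"
  unfolding hpos_def using hordI[of a q] by (auto simp: hahn_nonzero intro!: exI[of _ q])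

lemma hposD: "hpos a \<Longrightarrow> \<exists>q. hcoeff a q > 0 \<and> (\<forall>t<q. hcoeff a t = 0)"
  for a :: "'a::linordered_field hahn"
  unfolding hpos_def using hord_le[of a] by (meson leD)

lemma hpos_add: "hpos a \<Longrightarrow> hpos b \<Longrightarrow> hpos (a + b)"
  for a b :: "'a::linordered_field hahn"
proof -
  assume ab: "hpos a" "hpos b"
  obtain q where q: "hcoeff a q > 0" "\<And>t. t < q \<Longrightarrow> hcoeff a t = 0"
    using hposD[OF ab(1)] by auto
  obtain r where r: "hcoeff b r > 0" "\<And>t. t < r \<Longrightarrow> hcoeff b t = 0"
    using hposD[OF ab(2)] by auto
  show ?thesis
  proof (rule hposI)
    show "hcoeff (a + b) (min q r) > 0"
      using q r by (cases q r rule: linorder_cases) (auto simp: min_def add_pos_pos)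
    show "hcoeff (a + b) t = 0" if "t < min q r" for t
      using that q r by simp
  qed
qed

lemma hpos_mult: "hpos a \<Longrightarrow> hpos b \<Longrightarrow> hpos (a * b)"
  for a b :: "'a::linordered_field hahn"
proof -
  assume ab: "hpos a" "hpos b"
  obtain q where q: "hcoeff a q > 0" "\<And>t. t < q \<Longrightarrow> hcoeff a t = 0"
    using hposD[OF ab(1)] by auto
  obtain r where r: "hcoeff b r > 0" "\<And>t. t < r \<Longrightarrow> hcoeff b t = 0"
    using hposD[OF ab(2)] by auto
  show ?thesis
  proof (rule hposI)
    show "hcoeff (a * b) (q + r) > 0"
      using q r hcoeff_mult_lowest[of q a r b] by simp
    show "hcoeff (a * b) t = 0" if "t < q + r" for t
      by (rule hcoeff_mult_below[of q _ r]) (use q r that in auto)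
  qed
qed

lemma hpos_trichotomy: "a = 0 \<or> hpos a \<or> hpos (- a)" for a :: "'a::linordered_field hahn"
proof (cases "a = 0")
  case False
  then have *: "hcoeff a (hord a) \<noteq> 0" "\<And>t. t < hord a \<Longrightarrow> hcoeff a t = 0"
    using hord[OF False] by (auto dest: leD)
  show ?thesis
  proof (cases "hcoeff a (hord a) > 0")
    case True
    then show ?thesis using * by (simp add: hpos_def False)
  next
    case neg: False
    then have "hpos (- a)" using * by (intro hposI[of _ "hord a"]) auto
    then show ?thesis by simp
  qed
qed simp

lemma not_hpos_0: "\<not> hpos 0"
  by (simp add: hpos_def)

lemma hpos_uminus: "hpos a \<Longrightarrow> \<not> hpos (- a)" for a :: "'a::linordered_field hahn"
  using hpos_add[of a "- a"] not_hpos_0 by auto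

instantiation hahn :: (linordered_field) linordered_field
begin

definition "a < b \<longleftrightarrow> hpos (b - a :: 'a hahn)"
definition "a \<le> b \<longleftrightarrow> a < b \<or> a = (b :: 'a hahn)"
definition "\<bar>a\<bar> = (if 0 < a then a else - (a :: 'a hahn))"
definition "sgn a = (if a = 0 then 0 else if 0 < (a :: 'a hahn) then 1 else - 1)"

instance
proof
  fix a b c :: "'a hahn"
  have tri: "a = b \<or> a < b \<or> b < a" for a b :: "'a hahn"
    using hpos_trichotomy[of "b - a"] by (auto simp: less_hahn_def)
  have asym: "a < b \<Longrightarrow> \<not> b < a" for a b :: "'a hahn"
    using hpos_uminus[of "b - a"] by (auto simp: less_hahn_def)
  have trans: "a < b \<Longrightarrow> b < c \<Longrightarrow> a < c" for a b c :: "'a hahn"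
    using hpos_add[of "b - a" "c - b"] by (auto simp: less_hahn_def)
  show "(a < b) = (a \<le> b \<and> \<not> b \<le> a)"
    using asym[of a b] asym[of a a] by (auto simp: less_eq_hahn_def)
  show "a \<le> a" by (simp add: less_eq_hahn_def)
  show "a \<le> b \<Longrightarrow> b \<le> c \<Longrightarrow> a \<le> c"
    using trans by (auto simp: less_eq_hahn_def)
  show "a \<le> b \<Longrightarrow> b \<le> a \<Longrightarrow> a = b"
    using asym[of a b] by (auto simp: less_eq_hahn_def)
  show "a \<le> b \<or> b \<le> a"
    using tri by (auto simp: less_eq_hahn_def)
  show "a \<le> b \<Longrightarrow> c + a \<le> c + b"
    by (auto simp: less_eq_hahn_def less_hahn_def)
  show "a < b \<Longrightarrow> 0 < c \<Longrightarrow> c * a < c * b"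
    using hpos_mult[of c "b - a"] by (simp add: less_hahn_def right_diff_distrib)
  show "\<bar>a\<bar> = (if a < 0 then - a else a)"
    using tri[of a 0] asym[of a 0] asym[of "0 :: 'a hahn" 0] by (auto simp: abs_hahn_def)
  show "sgn a = (if a = 0 then 0 else if 0 < a then 1 else - 1)"
    by (rule sgn_hahn_def)
qed

end


subsection \<open>Real and complex series\<close>

abbreviation hof_real :: "real hahn \<Rightarrow> complex hahn" where
  "hof_real \<equiv> hmap complex_of_real"

abbreviation hRe :: "complex hahn \<Rightarrow> real hahn" where
  "hRe \<equiv> hmap Re"

text \<open>The subfield \<open>\<real>((\<hbar>\<^sup>\<rat>))\<close> of \<open>\<complex>((\<hbar>\<^sup>\<rat>))\<close>.\<close>

definition hreals :: "complex hahn set" where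
  "hreals = range hof_real"

definition hnonneg :: "complex hahn \<Rightarrow> bool" where
  "hnonneg z \<longleftrightarrow> (\<exists>r\<ge>0. z = hof_real r)"

lemma hof_real_hRe: "z \<in> hreals \<Longrightarrow> hof_real (hRe z) = z"
  by (auto simp: hreals_def hahn_eq_iff hcoeff_hmap)


section \<open>Smooth manifolds\<close>

text \<open>\<open>iter_deriv [v\<^sub>1, \<dots>, v\<^sub>r] f\<close> is the iterated directional derivative
  \<open>\<partial>\<^bsub>v\<^sub>1\<^esub> \<dots> \<partial>\<^bsub>v\<^sub>r\<^esub> f\<close>. On an open subset of a finite-dimensional space,
  \<open>smooth_on\<close> says that \<open>f\<close> is of class \<open>C\<^sup>\<infinity>\<close>.\<close>

fun iter_deriv :: "'e::real_normed_vector list \<Rightarrow> ('e \<Rightarrow> 'b::real_normed_vector) \<Rightarrow> 'e \<Rightarrow> 'b" where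
  "iter_deriv [] f = f"
| "iter_deriv (v # vs) f = (\<lambda>x. frechet_derivative (iter_deriv vs f) (at x) v)"

definition smooth_on :: "'e::real_normed_vector set \<Rightarrow> ('e \<Rightarrow> 'b::real_normed_vector) \<Rightarrow> bool" where
  "smooth_on S f \<longleftrightarrow> (\<forall>vs. \<forall>x\<in>S. iter_deriv vs f differentiable (at x))"

text \<open>The points of the manifold \<open>M\<close> are the elements of the type \<open>'m\<close>. A chart is a pair
  \<open>(U, \<phi>)\<close> with values in the model space \<open>'e\<close>, which is only required to be finite-dimensional
  and normed (rather than of class \<open>euclidean_space\<close>), so that dimension 0 is not excluded.\<close>

type_synonym ('m, 'e) chart = "'m set \<times> ('m \<Rightarrow> 'e)"

definition smooth_atlas ::
    "('m::{t2_space,second_countable_topology}, 'e::real_normed_vector) chart set \<Rightarrow> bool" where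
  "smooth_atlas A \<longleftrightarrow>
    (\<exists>B :: 'e set. finite B \<and> span B = UNIV) \<and>
    (\<Union>(U, \<phi>)\<in>A. U) = UNIV \<and>
    (\<forall>(U, \<phi>)\<in>A. open U \<and> open (\<phi> ` U) \<and> homeomorphism U (\<phi> ` U) \<phi> (inv_into U \<phi>)) \<and>
    (\<forall>(U, \<phi>)\<in>A. \<forall>(V, \<psi>)\<in>A. smooth_on (\<phi> ` (U \<inter> V)) (\<psi> \<circ> inv_into U \<phi>))"

definition smooth_fun :: "('m, 'e::real_normed_vector) chart set \<Rightarrow> ('m \<Rightarrow> 'b::real_normed_vector) \<Rightarrow> bool" where
  "smooth_fun A f \<longleftrightarrow> (\<forall>(U, \<phi>)\<in>A. smooth_on (\<phi> ` U) (f \<circ> inv_into U \<phi>))"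

text \<open>Tangent vectors at \<open>p\<close> are the derivations at \<open>p\<close> of the algebra of real smooth functions,
  represented by their unique extensions that vanish on the non-smooth functions.\<close>

type_synonym 'm tvec = "('m \<Rightarrow> real) \<Rightarrow> real"

definition tangent_space :: "('m, 'e::real_normed_vector) chart set \<Rightarrow> 'm \<Rightarrow> 'm tvec set" where
  "tangent_space A p = {X.
    (\<forall>f. \<not> smooth_fun A f \<longrightarrow> X f = 0) \<and>
    (\<forall>c f. smooth_fun A f \<longrightarrow> X (\<lambda>x. c * f x) = c * X f) \<and>
    (\<forall>f g. smooth_fun A f \<and> smooth_fun A g \<longrightarrow>
      X (f + g) = X f + X g \<and> X (f * g) = f p * X g + g p * X f)}"

text \<open>The tangent vector \<open>\<partial>\<^sub>v\<close>, in the chart \<open>(U, \<phi>)\<close>, at the point with coordinates \<open>x\<close>.\<close>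

definition coord_vec ::
    "('m, 'e::real_normed_vector) chart set \<Rightarrow> ('m, 'e) chart \<Rightarrow> 'e \<Rightarrow> 'e \<Rightarrow> 'm tvec" where
  "coord_vec A = (\<lambda>(U, \<phi>) v x f.
    if smooth_fun A f then frechet_derivative (f \<circ> inv_into U \<phi>) (at x) v else 0)"


section \<open>Symplectic manifolds and the Poisson bracket\<close>

definition form_coeff ::
    "('m, 'e::real_normed_vector) chart set \<Rightarrow> ('m \<Rightarrow> 'm tvec \<Rightarrow> 'm tvec \<Rightarrow> real) \<Rightarrow>
      ('m, 'e) chart \<Rightarrow> 'e \<Rightarrow> 'e \<Rightarrow> 'e \<Rightarrow> real" where
  "form_coeff A \<omega> = (\<lambda>(U, \<phi>) u v x.
    \<omega> (inv_into U \<phi> x) (coord_vec A (U, \<phi>) u x) (coord_vec A (U, \<phi>) v x))"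

definition two_form ::
    "('m, 'e::real_normed_vector) chart set \<Rightarrow> ('m \<Rightarrow> 'm tvec \<Rightarrow> 'm tvec \<Rightarrow> real) \<Rightarrow> bool" where
  "two_form A \<omega> \<longleftrightarrow>
    (\<forall>p. \<forall>X\<in>tangent_space A p. \<forall>Y\<in>tangent_space A p.
      \<omega> p Y X = - \<omega> p X Y \<and>
      (\<forall>c. \<omega> p (\<lambda>f. c * X f) Y = c * \<omega> p X Y) \<and>
      (\<forall>Z\<in>tangent_space A p. \<omega> p (X + Z) Y = \<omega> p X Y + \<omega> p Z Y)) \<and>
    (\<forall>(U, \<phi>)\<in>A. \<forall>u v. smooth_on (\<phi> ` U) (form_coeff A \<omega> (U, \<phi>) u v))"

text \<open>\<open>d\<omega>(\<partial>\<^sub>u, \<partial>\<^sub>v, \<partial>\<^sub>w) = 0\<close> in every chart.\<close>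

definition closed_form ::
    "('m, 'e::real_normed_vector) chart set \<Rightarrow> ('m \<Rightarrow> 'm tvec \<Rightarrow> 'm tvec \<Rightarrow> real) \<Rightarrow> bool" where
  "closed_form A \<omega> \<longleftrightarrow> (\<forall>(U, \<phi>)\<in>A. \<forall>x\<in>\<phi> ` U. \<forall>u v w.
    frechet_derivative (form_coeff A \<omega> (U, \<phi>) v w) (at x) u +
    frechet_derivative (form_coeff A \<omega> (U, \<phi>) w u) (at x) v +
    frechet_derivative (form_coeff A \<omega> (U, \<phi>) u v) (at x) w = 0)"

definition nondegenerate ::
    "('m, 'e::real_normed_vector) chart set \<Rightarrow> ('m \<Rightarrow> 'm tvec \<Rightarrow> 'm tvec \<Rightarrow> real) \<Rightarrow> bool" where
  "nondegenerate A \<omega> \<longleftrightarrow> (\<forall>p. \<forall>X\<in>tangent_space A p.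
    (\<forall>Y\<in>tangent_space A p. \<omega> p X Y = 0) \<longrightarrow> X = 0)"

definition symplectic_manifold ::
    "('m::{t2_space,second_countable_topology}, 'e::real_normed_vector) chart set \<Rightarrow>
      ('m \<Rightarrow> 'm tvec \<Rightarrow> 'm tvec \<Rightarrow> real) \<Rightarrow> bool" where
  "symplectic_manifold A \<omega> \<longleftrightarrow>
    smooth_atlas A \<and> two_form A \<omega> \<and> closed_form A \<omega> \<and> nondegenerate A \<omega>"

text \<open>Hamiltonian vector field \<open>X\<^sub>f\<close> with \<open>\<omega>(X\<^sub>f, Y) = df(Y)\<close>, and \<open>{f, g} = \<omega>(X\<^sub>f, X\<^sub>g)\<close>. For
  \<open>\<omega> = dq \<and> dp\<close> this gives \<open>{q, p} = 1\<close>. The bracket of complex-valued functions is the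
  complex bilinear extension.\<close>

definition hamiltonian_vec ::
    "('m, 'e::real_normed_vector) chart set \<Rightarrow> ('m \<Rightarrow> 'm tvec \<Rightarrow> 'm tvec \<Rightarrow> real) \<Rightarrow>
      ('m \<Rightarrow> real) \<Rightarrow> 'm \<Rightarrow> 'm tvec" where
  "hamiltonian_vec A \<omega> f p =
    (THE X. X \<in> tangent_space A p \<and> (\<forall>Y\<in>tangent_space A p. \<omega> p X Y = Y f))"

definition poisson_real ::
    "('m, 'e::real_normed_vector) chart set \<Rightarrow> ('m \<Rightarrow> 'm tvec \<Rightarrow> 'm tvec \<Rightarrow> real) \<Rightarrow>
      ('m \<Rightarrow> real) \<Rightarrow> ('m \<Rightarrow> real) \<Rightarrow> 'm \<Rightarrow> real" where
  "poisson_real A \<omega> f g p = \<omega> p (hamiltonian_vec A \<omega> f p) (hamiltonian_vec A \<omega> g p)"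

definition poisson ::
    "('m, 'e::real_normed_vector) chart set \<Rightarrow> ('m \<Rightarrow> 'm tvec \<Rightarrow> 'm tvec \<Rightarrow> real) \<Rightarrow>
      ('m \<Rightarrow> complex) \<Rightarrow> ('m \<Rightarrow> complex) \<Rightarrow> 'm \<Rightarrow> complex" where
  "poisson A \<omega> f g p =
    (let P = (\<lambda>a b. poisson_real A \<omega> a b p) in
      Complex (P (Re \<circ> f) (Re \<circ> g) - P (Im \<circ> f) (Im \<circ> g))
              (P (Re \<circ> f) (Im \<circ> g) + P (Im \<circ> f) (Re \<circ> g)))"


section \<open>Star products\<close>

text \<open>Near every point, in some chart, \<open>B(f, g) = \<Sum>\<^sub>i a\<^sub>i \<cdot> \<partial>\<^bsub>us i\<^esub> f \<cdot> \<partial>\<^bsub>vs i\<^esub> g\<close> with finitely many smooth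
  coefficients \<open>a\<^sub>i\<close>. The order need not be bounded globally on \<open>M\<close>.\<close>

definition bidifferential ::
    "('m::topological_space, 'e::real_normed_vector) chart set \<Rightarrow>
      (('m \<Rightarrow> complex) \<Rightarrow> ('m \<Rightarrow> complex) \<Rightarrow> 'm \<Rightarrow> complex) \<Rightarrow> bool" where
  "bidifferential A B \<longleftrightarrow>
    (\<forall>f g. smooth_fun A f \<and> smooth_fun A g \<longrightarrow> smooth_fun A (B f g)) \<and>
    (\<forall>p. \<exists>(U, \<phi>)\<in>A. \<exists>V. open V \<and> p \<in> V \<and> V \<subseteq> U \<and>
      (\<exists>(N::nat) (a :: nat \<Rightarrow> 'e \<Rightarrow> complex) us vs. (\<forall>i<N. smooth_on (\<phi> ` V) (a i)) \<and>
        (\<forall>f g. smooth_fun A f \<and> smooth_fun A g \<longrightarrow> (\<forall>x\<in>\<phi> ` V.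
          B f g (inv_into U \<phi> x) =
            (\<Sum>i<N. a i x * iter_deriv (us i) (f \<circ> inv_into U \<phi>) x
                          * iter_deriv (vs i) (g \<circ> inv_into U \<phi>) x)))))"

text \<open>\<open>C\<^sup>\<infinity>(M)((\<hbar>\<^sup>\<rat>))\<close>, its \<open>\<complex>((\<hbar>\<^sup>\<rat>))\<close>-scalar multiplication and coefficientwise conjugation.\<close>

definition smooth_series :: "('m, 'e::real_normed_vector) chart set \<Rightarrow> ('m \<Rightarrow> complex) hahn set" where
  "smooth_series A = {F. \<forall>q. smooth_fun A (hcoeff F q)}"

definition hscale :: "complex hahn \<Rightarrow> ('m \<Rightarrow> complex) hahn \<Rightarrow> ('m \<Rightarrow> complex) hahn" where
  "hscale a F = hconv (\<lambda>c f x. c * f x) a F"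

definition hcnj :: "('m \<Rightarrow> complex) hahn \<Rightarrow> ('m \<Rightarrow> complex) hahn" where
  "hcnj F = hmap (\<lambda>f x. cnj (f x)) F"

text \<open>The series \<open>\<Sum>\<^sub>k C\<^sub>k(F, G) \<hbar>\<^sup>k\<close>; each of its coefficients is a finite sum.\<close>

definition star_series ::
    "(nat \<Rightarrow> ('m \<Rightarrow> complex) \<Rightarrow> ('m \<Rightarrow> complex) \<Rightarrow> 'm \<Rightarrow> complex) \<Rightarrow>
      ('m \<Rightarrow> complex) hahn \<Rightarrow> ('m \<Rightarrow> complex) hahn \<Rightarrow> ('m \<Rightarrow> complex) hahn" where
  "star_series C F G = Hahn (\<lambda>q.
    \<Sum>k\<in>{k. hcoeff (hconv (C k) F G) (q - of_nat k) \<noteq> 0}. hcoeff (hconv (C k) F G) (q - of_nat k))"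

lemma wo_range_of_nat: "wo_set (range (of_nat :: nat \<Rightarrow> rat))"
  unfolding wo_set_def
proof (intro allI impI)
  fix T :: "rat set" assume T: "T \<subseteq> range of_nat" "T \<noteq> {}"
  define k where "k = (LEAST k. rat_of_nat k \<in> T)"
  obtain j where "rat_of_nat j \<in> T" using T by auto
  then have k: "rat_of_nat k \<in> T" unfolding k_def by (rule LeastI)
  have "rat_of_nat k \<le> t" if tT: "t \<in> T" for t
  proof -
    obtain i where i: "t = rat_of_nat i" using subsetD[OF T(1) tT] by auto
    then have "k \<le> i" unfolding k_def using tT by (auto intro: Least_le)
    then show ?thesis by (simp add: i)
  qed
  then show "\<exists>m\<in>T. \<forall>t\<in>T. m \<le> t" using k by auto
qed

lemma finite_star_terms: "finite {k. hcoeff (hconv (C k) F G) (q - of_nat k) \<noteq> 0}" (is "finite ?K")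
proof -
  let ?S = "{s + t | s t. s \<in> hsupp F \<and> t \<in> hsupp G}"
  let ?P = "{(s, t). s \<in> ?S \<and> t \<in> range rat_of_nat \<and> s + t = q}"
  have "finite ?P"
    by (rule finite_sum_decomp) (simp_all add: wo_set_sum wo_range_of_nat)
  moreover have "(\<lambda>k. (q - of_nat k, of_nat k)) ` ?K \<subseteq> ?P"
    using hsupp_hconv by (fastforce simp: hsupp_def)
  moreover have "inj_on (\<lambda>k. (q - of_nat k, rat_of_nat k)) ?K"
    by (auto intro!: inj_onI)
  ultimately show ?thesis by (meson finite_imageD finite_subset)
qed

lemma hcoeff_star_series:
  "hcoeff (star_series C F G) q = (\<Sum>k\<in>{k. hcoeff (hconv (C k) F G) (q - of_nat k) \<noteq> 0}.
    hcoeff (hconv (C k) F G) (q - of_nat k))"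
proof -
  let ?f = "\<lambda>q. \<Sum>k\<in>{k. hcoeff (hconv (C k) F G) (q - of_nat k) \<noteq> 0}.
    hcoeff (hconv (C k) F G) (q - of_nat k)"
  let ?S = "{s + t | s t. s \<in> hsupp F \<and> t \<in> hsupp G}"
  have "{q. ?f q \<noteq> 0} \<subseteq> {s + t | s t. s \<in> ?S \<and> t \<in> range rat_of_nat}"
  proof
    fix q assume "q \<in> {q. ?f q \<noteq> 0}"
    then obtain k where "hcoeff (hconv (C k) F G) (q - of_nat k) \<noteq> 0"
      by (auto elim: sum.not_neutral_contains_not_neutral)
    then have "q - of_nat k \<in> ?S" using hsupp_hconv[of "C k" F G] by (auto simp: hsupp_def)
    moreover have "q = (q - of_nat k) + of_nat k" by simp
    ultimately show "q \<in> {s + t | s t. s \<in> ?S \<and> t \<in> range rat_of_nat}" by blast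
  qed
  moreover have "wo_set {s + t | s t. s \<in> ?S \<and> t \<in> range rat_of_nat}"
    by (rule wo_set_sum) (simp_all add: wo_set_sum wo_range_of_nat)
  ultimately have "wo_set {q. ?f q \<noteq> 0}" by (rule wo_set_subset[rotated])
  then show ?thesis unfolding star_series_def by (subst hcoeff_Hahn) simp_all
qed

definition star_product ::
    "('m::topological_space, 'e::real_normed_vector) chart set \<Rightarrow>
      ('m \<Rightarrow> 'm tvec \<Rightarrow> 'm tvec \<Rightarrow> real) \<Rightarrow>
      (('m \<Rightarrow> complex) hahn \<Rightarrow> ('m \<Rightarrow> complex) hahn \<Rightarrow> ('m \<Rightarrow> complex) hahn) \<Rightarrow> bool" where
  "star_product A \<omega> star \<longleftrightarrow>
    (\<forall>F\<in>smooth_series A. \<forall>G\<in>smooth_series A. star F G \<in> smooth_series A) \<and>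
    (\<forall>F\<in>smooth_series A. \<forall>G\<in>smooth_series A. \<forall>H\<in>smooth_series A.
      star (star F G) H = star F (star G H) \<and>
      star (F + G) H = star F H + star G H \<and>
      star F (G + H) = star F G + star F H) \<and>
    (\<forall>a. \<forall>F\<in>smooth_series A. \<forall>G\<in>smooth_series A.
      star (hscale a F) G = hscale a (star F G) \<and>
      star F (hscale a G) = hscale a (star F G)) \<and>
    (\<exists>C. (\<forall>k. bidifferential A (C k)) \<and>
      (\<forall>F\<in>smooth_series A. \<forall>G\<in>smooth_series A. star F G = star_series C F G) \<and>
      (\<forall>f g. smooth_fun A f \<and> smooth_fun A g \<longrightarrow> C 0 f g = f * g) \<and>
      (\<forall>k\<ge>1. \<forall>f. smooth_fun A f \<longrightarrow> C k 1 f = 0 \<and> C k f 1 = 0) \<and>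
      (\<forall>f g. smooth_fun A f \<and> smooth_fun A g \<longrightarrow>
        C 1 f g - C 1 g f = (\<lambda>p. \<i> * poisson A \<omega> f g p)))"

definition star_bracket ::
    "(('m \<Rightarrow> complex) hahn \<Rightarrow> ('m \<Rightarrow> complex) hahn \<Rightarrow> ('m \<Rightarrow> complex) hahn) \<Rightarrow>
      ('m \<Rightarrow> complex) hahn \<Rightarrow> ('m \<Rightarrow> complex) hahn \<Rightarrow> ('m \<Rightarrow> complex) hahn" where
  "star_bracket star F G = hscale (1 / (hconst \<i> * hbar)) (star F G - star G F)"


section \<open>States\<close>

definition positive_functional ::
    "('m, 'e::real_normed_vector) chart set \<Rightarrow>
      (('m \<Rightarrow> complex) hahn \<Rightarrow> ('m \<Rightarrow> complex) hahn \<Rightarrow> ('m \<Rightarrow> complex) hahn) \<Rightarrow>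
      (('m \<Rightarrow> complex) hahn \<Rightarrow> complex hahn) \<Rightarrow> bool" where
  "positive_functional A star \<rho> \<longleftrightarrow>
    (\<forall>F\<in>smooth_series A. \<forall>G\<in>smooth_series A. \<rho> (F + G) = \<rho> F + \<rho> G) \<and>
    (\<forall>a. \<forall>F\<in>smooth_series A. \<rho> (hscale a F) = a * \<rho> F) \<and>
    (\<forall>F\<in>smooth_series A. hnonneg (\<rho> (star (hcnj F) F)))"

definition state ::
    "('m, 'e::real_normed_vector) chart set \<Rightarrow>
      (('m \<Rightarrow> complex) hahn \<Rightarrow> ('m \<Rightarrow> complex) hahn \<Rightarrow> ('m \<Rightarrow> complex) hahn) \<Rightarrow>
      (('m \<Rightarrow> complex) hahn \<Rightarrow> complex hahn) \<Rightarrow> bool" where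
  "state A star \<rho> \<longleftrightarrow> positive_functional A star \<rho> \<and> \<rho> 1 = 1"

text \<open>The squared uncertainty \<open>(\<Delta>X)\<^sup>2\<close>.\<close>

definition uncertainty_sq ::
    "(('m \<Rightarrow> complex) hahn \<Rightarrow> ('m \<Rightarrow> complex) hahn \<Rightarrow> ('m \<Rightarrow> complex) hahn) \<Rightarrow>
      (('m \<Rightarrow> complex) hahn \<Rightarrow> complex hahn) \<Rightarrow> ('m \<Rightarrow> complex) hahn \<Rightarrow> complex hahn" where
  "uncertainty_sq star \<rho> X = \<rho> (star X X) - (\<rho> X)\<^sup>2"

end

theory Submission
  imports Defs
begin

text \<open>
  Uncertainties are squared norms of centred observables. If \<open>\<rho>(X)\<close> is real and
  \<open>Y = X - \<rho>(X)\<cdot>1\<close>, then \<open>(\<Delta>X)\<^sup>2 = \<rho>(Y * Y)\<close>, and the commutator of two observables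
  does not change when both are centred. For real \<open>Y\<close>, \<open>Z\<close> and a sign \<open>\<epsilon>\<close>, positivity of \<open>\<rho>\<close> at
  \<open>Y + i\<epsilon>Z\<close> says
  \<open>\<rho>(Y * Y) + \<rho>(Z * Z) + i\<epsilon> \<rho>(Y * Z - Z * Y) \<ge> 0\<close>, and since \<open>Y * Z - Z * Y = i\<hbar> {Y, Z}\<^sub>*\<close>, the two signs together give
  \<open>(\<Delta>X\<^sub>j)\<^sup>2 + (\<Delta>X\<^sub>k)\<^sup>2 \<ge> \<hbar> |\<rho>({X\<^sub>j, X\<^sub>k}\<^sub>*)|\<close> (lemma \<open>pair_uncertainty\<close>). Summation over all pairs
  yields the theorem, because each index lies in \<open>n - 1\<close> pairs.

  Positivity also supplies the reality statements: \<open>\<rho>(X)\<close> is real because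
  \<open>\<rho>((X + 1) * (X + 1))\<close>, \<open>\<rho>(X * X)\<close> and \<open>\<rho>(1)\<close> are, and \<open>\<hbar> \<rho>({X, Z}\<^sub>*)\<close> is real because it
  is the difference of the nonnegative series above and the two squared uncertainties. The
  computations are legitimate because smooth series form a \<open>\<complex>((\<hbar>\<^sup>\<rat>))\<close>-subspace containing \<open>1\<close>,
  and because \<open>1\<close> is the unit of the star product.
\<close>

section \<open>Smooth functions form a complex vector space\<close>

lemma iter_deriv_const: "iter_deriv vs (\<lambda>_. c) = (\<lambda>_. if vs = [] then c else 0)"
proof (induction vs)
  case (Cons v vs)
  have "frechet_derivative (\<lambda>_. d) (at x) = (\<lambda>_. 0)"
    for d :: 'b and x :: 'a
    by (rule frechet_derivative_at[symmetric]) (rule has_derivative_const)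
  then show ?case by (simp add: Cons)
qed simp

lemma smooth_fun_const: "smooth_fun A (\<lambda>_. c)"
  by (auto simp: smooth_fun_def smooth_on_def comp_def iter_deriv_const)

text \<open>Openness of \<open>S\<close> is what makes the induction work: the derivative at \<open>x\<close> depends only on the
  values near \<open>x\<close>, where the induction hypothesis is available.\<close>

lemma iter_deriv_linear_add:
  assumes L: "bounded_linear L" and S: "open S" and f: "smooth_on S f" and g: "smooth_on S g"
    and "x \<in> S"
  shows "iter_deriv vs (\<lambda>x. L (f x) + g x) x = L (iter_deriv vs f x) + iter_deriv vs g x"
    (is ?eq)
    and "iter_deriv vs (\<lambda>x. L (f x) + g x) differentiable (at x)" (is ?diff)
proof -
  have deriv: "(iter_deriv vs (\<lambda>x. L (f x) + g x) has_derivative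
      (\<lambda>v. L (frechet_derivative (iter_deriv vs f) (at x) v)
        + frechet_derivative (iter_deriv vs g) (at x) v)) (at x)"
    if eq: "\<And>x. x \<in> S \<Longrightarrow>
      iter_deriv vs (\<lambda>x. L (f x) + g x) x = L (iter_deriv vs f x) + iter_deriv vs g x"
      and x: "x \<in> S" for vs x
  proof (rule has_derivative_transform_within_open[OF _ S x])
    have "(iter_deriv vs f has_derivative frechet_derivative (iter_deriv vs f) (at x)) (at x)"
      "(iter_deriv vs g has_derivative frechet_derivative (iter_deriv vs g) (at x)) (at x)"
      using f g x by (auto simp: smooth_on_def frechet_derivative_works[symmetric])
    then show "((\<lambda>x. L (iter_deriv vs f x) + iter_deriv vs g x) has_derivative
        (\<lambda>v. L (frechet_derivative (iter_deriv vs f) (at x) v)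
          + frechet_derivative (iter_deriv vs g) (at x) v)) (at x)"
      by (intro has_derivative_add bounded_linear.has_derivative[OF L])
  qed (simp add: eq)
  have eq: "\<And>x. x \<in> S \<Longrightarrow>
      iter_deriv vs (\<lambda>x. L (f x) + g x) x = L (iter_deriv vs f x) + iter_deriv vs g x" for vs
  proof (induction vs)
    case (Cons v vs)
    show ?case
      using frechet_derivative_at[OF deriv[OF Cons.IH Cons.prems]] by (simp add: fun_eq_iff)
  qed simp
  show ?eq using eq \<open>x \<in> S\<close> by blast
  show ?diff using deriv[OF eq \<open>x \<in> S\<close>] unfolding differentiable_def by blast
qed

lemma smooth_fun_linear_add:
  assumes "smooth_atlas A" "bounded_linear L" "smooth_fun A f" "smooth_fun A g"
  shows "smooth_fun A (\<lambda>p. L (f p) + g p)"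
  unfolding smooth_fun_def smooth_on_def
proof safe
  fix U \<phi> vs p assume U: "(U, \<phi>) \<in> A" and p: "p \<in> U"
  then have "open (\<phi> ` U)" using assms(1) by (auto simp: smooth_atlas_def)
  moreover have "smooth_on (\<phi> ` U) (f \<circ> inv_into U \<phi>)" "smooth_on (\<phi> ` U) (g \<circ> inv_into U \<phi>)"
    using assms(3,4) U by (auto simp: smooth_fun_def)
  ultimately show "iter_deriv vs ((\<lambda>p. L (f p) + g p) \<circ> inv_into U \<phi>) differentiable at (\<phi> p)"
    using iter_deriv_linear_add(2)[OF assms(2), of "\<phi> ` U" "f \<circ> inv_into U \<phi>"
        "g \<circ> inv_into U \<phi>" "\<phi> p" vs] p
    by (simp add: comp_def)
qed

lemma smooth_series_add:
  assumes "smooth_atlas A" "F \<in> smooth_series A" "G \<in> smooth_series A"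
  shows "F + G \<in> smooth_series A"
  using assms smooth_fun_linear_add[OF assms(1) bounded_linear_ident]
  by (auto simp: smooth_series_def plus_fun_def)

lemma smooth_series_diff:
  assumes "smooth_atlas A" "F \<in> smooth_series A" "G \<in> smooth_series A"
  shows "F - G \<in> smooth_series A"
proof -
  have "bounded_linear (\<lambda>z::complex. - z)"
    by (rule bounded_linear_minus[OF bounded_linear_ident])
  from smooth_fun_linear_add[OF assms(1) this] show ?thesis
    using assms(2,3) by (auto simp: smooth_series_def fun_diff_def)
qed

lemma smooth_series_hscale:
  assumes "smooth_atlas A" "F \<in> smooth_series A"
  shows "hscale a F \<in> smooth_series A"
proof -
  have "smooth_fun A (\<Sum>i\<in>I. (\<lambda>x. c i * hcoeff F (t i) x))"
    if "finite I" for I :: "(rat \<times> rat) set" and c t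
    using that
  proof (induction I rule: finite_induct)
    case empty
    then show ?case by (simp add: zero_fun_def smooth_fun_const)
  next
    case (insert i I)
    have "bounded_linear (\<lambda>z. c i * z)" by (rule bounded_linear_mult_right)
    from smooth_fun_linear_add[OF assms(1) this _ insert.IH] show ?case
      using insert.hyps assms(2) by (simp add: smooth_series_def plus_fun_def)
  qed
  then show ?thesis
    by (simp add: smooth_series_def hscale_def hcoeff_hconv case_prod_beta)
qed

lemma smooth_series_1: "1 \<in> smooth_series A"
  using smooth_fun_const[of A 0] smooth_fun_const[of A 1]
  by (auto simp: smooth_series_def hcoeff_1 zero_fun_def one_fun_def)


section \<open>Conjugation and real series\<close>

lemma hcoeff_hcnj: "hcoeff (hcnj F) q = (\<lambda>x. cnj (hcoeff F q x))"
  unfolding hcnj_def by (subst hcoeff_hmap) (auto simp: zero_fun_def)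

lemma hcnj_add: "hcnj (F + G) = hcnj F + hcnj G"
  by (simp add: hahn_eq_iff hcoeff_hcnj plus_fun_def)

lemma hcnj_1: "hcnj 1 = 1"
  by (auto simp: hahn_eq_iff hcoeff_hcnj hcoeff_1 zero_fun_def one_fun_def)

lemma hcnj_hscale: "hcnj (hscale a F) = hscale (hmap cnj a) (hcnj F)"
proof -
  have pairs: "hpairs (hmap cnj a) (hcnj F) q = hpairs a F q" for q
    by (auto simp: hpairs_def hsupp_def hcoeff_hmap hcoeff_hcnj fun_eq_iff)
  have cnj_sum: "cnj (sum h I x) = (\<Sum>i\<in>I. (\<lambda>x. cnj (h i x))) x"
    for h :: "rat \<times> rat \<Rightarrow> 'm \<Rightarrow> complex" and I x
    by (induction I rule: infinite_finite_induct) auto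
  show ?thesis
    by (rule hahn_eqI)
      (simp add: hcoeff_hcnj hscale_def hcoeff_hconv pairs fun_eq_iff cnj_sum case_prod_beta
        hcoeff_hmap)
qed

lemma hreals_iff: "z \<in> hreals \<longleftrightarrow> (\<forall>q. Im (hcoeff z q) = 0)"
proof
  assume "\<forall>q. Im (hcoeff z q) = 0"
  then have "z = hof_real (hRe z)" by (simp add: hahn_eq_iff hcoeff_hmap complex_eq_iff)
  then show "z \<in> hreals" unfolding hreals_def by blast
qed (auto simp: hreals_def hcoeff_hmap)

lemma hmap_cnj_hreals: "z \<in> hreals \<Longrightarrow> hmap cnj z = z"
  by (simp add: hreals_iff hahn_eq_iff hcoeff_hmap complex_eq_iff)

lemma hnonneg_iff: "hnonneg z \<longleftrightarrow> z \<in> hreals \<and> 0 \<le> hRe z"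
proof
  assume "hnonneg z"
  then obtain r where r: "r \<ge> 0" "z = hof_real r" by (auto simp: hnonneg_def)
  moreover have "hRe (hof_real r) = r" by (simp add: hahn_eq_iff hcoeff_hmap)
  ultimately show "z \<in> hreals \<and> 0 \<le> hRe z" by (auto simp: hreals_def)
next
  assume "z \<in> hreals \<and> 0 \<le> hRe z"
  then show "hnonneg z" unfolding hnonneg_def by (metis hof_real_hRe)
qed

lemma hRe_add: "hRe (a + b) = hRe a + hRe b"
  by (simp add: hahn_eq_iff hcoeff_hmap)

lemma hRe_uminus: "hRe (- a) = - hRe a"
  by (simp add: hahn_eq_iff hcoeff_hmap)

lemma hRe_hbar_mult: "hRe (hbar * a) = hbar * hRe a"
  by (simp add: hahn_eq_iff hcoeff_hmap hcoeff_hmonom_mult)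

lemma hbar_pos: "(0 :: real hahn) < hbar"
  unfolding less_hahn_def by (rule hposI[of _ 1]) (auto simp: hcoeff_hmonom)

lemma hconst_i_square: "hconst \<i> * (hconst \<i> * a) = - a"
  by (simp add: hahn_eq_iff hcoeff_hmonom_mult)


section \<open>The unit of the star product\<close>

lemma hsupp_1: "hsupp (1 :: 'a::comm_ring_1 hahn) = {0}"
  by (auto simp: hsupp_def hcoeff_1)

text \<open>For use with \<open>F = 1\<close> or \<open>G = 1\<close>, where the operators \<open>C\<^sub>k\<close> with \<open>k \<ge> 1\<close> vanish.\<close>

lemma hcoeff_star_series_order_0:
  assumes "\<And>k q. k \<ge> 1 \<Longrightarrow> hcoeff (hconv (C k) F G) q = 0"
  shows "hcoeff (star_series C F G) q = hcoeff (hconv (C 0) F G) q"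
proof -
  have "hcoeff (star_series C F G) q =
      (\<Sum>k\<in>{0}. hcoeff (hconv (C k) F G) (q - of_nat k))"
    unfolding hcoeff_star_series
    by (rule sum.mono_neutral_left)
      (use assms in \<open>auto simp: Suc_le_eq intro: ccontr\<close>)
  then show ?thesis by simp
qed

lemma hpairs_1_left: "hpairs 1 F q = (if hcoeff F q = 0 then {} else {(0, q)})"
  by (auto simp: hpairs_def hsupp_1) (auto simp: hsupp_def)

lemma hpairs_1_right: "hpairs F 1 q = (if hcoeff F q = 0 then {} else {(q, 0)})"
  by (auto simp: hpairs_def hsupp_1) (auto simp: hsupp_def)

lemma star_product_unit:
  assumes star: "star_product A \<omega> star" and F: "F \<in> smooth_series A"
  shows "star 1 F = F" "star F 1 = F"
proof -
  obtain C where
    "\<forall>F\<in>smooth_series A. \<forall>G\<in>smooth_series A. star F G = star_series C F G"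
    "\<forall>f g. smooth_fun A f \<and> smooth_fun A g \<longrightarrow> C 0 f g = f * g"
    "\<forall>k\<ge>1. \<forall>f. smooth_fun A f \<longrightarrow> C k 1 f = 0 \<and> C k f 1 = 0"
    using star unfolding star_product_def by (elim conjE exE) (rule that; assumption)
  then have C: "F \<in> smooth_series A \<Longrightarrow> G \<in> smooth_series A \<Longrightarrow> star F G = star_series C F G"
    and C0: "smooth_fun A f \<Longrightarrow> smooth_fun A g \<Longrightarrow> C 0 f g = f * g"
    and Ck: "k \<ge> 1 \<Longrightarrow> smooth_fun A f \<Longrightarrow> C k 1 f = 0 \<and> C k f 1 = 0" for F G f g k
    by simp_all
  have smooth: "smooth_fun A (hcoeff F q)" "smooth_fun A (1 :: 'a \<Rightarrow> complex)" for q
    using F smooth_fun_const[of A 1] by (auto simp: smooth_series_def one_fun_def)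
  show "star 1 F = F"
    unfolding C[OF smooth_series_1 F]
    by (rule hahn_eqI, subst hcoeff_star_series_order_0)
      (auto simp: hcoeff_hconv hpairs_1_left hcoeff_1 Ck C0 smooth)
  show "star F 1 = F"
    unfolding C[OF F smooth_series_1]
    by (rule hahn_eqI, subst hcoeff_star_series_order_0)
      (auto simp: hcoeff_hconv hpairs_1_right hcoeff_1 Ck C0 smooth)
qed


section \<open>Positivity of a state\<close>

locale star_state =
  fixes A :: "('m::{t2_space,second_countable_topology}, 'e::real_normed_vector) chart set"
    and \<omega> :: "'m \<Rightarrow> 'm tvec \<Rightarrow> 'm tvec \<Rightarrow> real"
    and star :: "('m \<Rightarrow> complex) hahn \<Rightarrow> ('m \<Rightarrow> complex) hahn \<Rightarrow> ('m \<Rightarrow> complex) hahn"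
    and \<rho> :: "('m \<Rightarrow> complex) hahn \<Rightarrow> complex hahn"
  assumes atlas: "smooth_atlas A"
    and star: "star_product A \<omega> star"
    and state: "state A star \<rho>"
begin

definition observable :: "('m \<Rightarrow> complex) hahn \<Rightarrow> bool" where
  "observable F \<longleftrightarrow> F \<in> smooth_series A \<and> hcnj F = F"

lemma observable_smooth: "observable F \<Longrightarrow> F \<in> smooth_series A"
  by (simp add: observable_def)

lemma observable_1: "observable 1"
  by (simp add: observable_def smooth_series_1 hcnj_1)

lemma observable_shift:
  assumes "observable X" "b \<in> hreals"
  shows "observable (X + hscale b 1)"
  using assms
  by (simp add: observable_def smooth_series_add[OF atlas] smooth_series_hscale[OF atlas]
      smooth_series_1 hcnj_add hcnj_hscale hcnj_1 hmap_cnj_hreals)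

text \<open>This form is bilinear over \<open>\<complex>((\<hbar>\<^sup>\<rat>))\<close>, so the algebra of star products reduces to arithmetic
  in the field of scalars.\<close>

definition corr :: "('m \<Rightarrow> complex) hahn \<Rightarrow> ('m \<Rightarrow> complex) hahn \<Rightarrow> complex hahn" where
  "corr F G = \<rho> (star F G)"

lemma star_smooth:
  "F \<in> smooth_series A \<Longrightarrow> G \<in> smooth_series A \<Longrightarrow> star F G \<in> smooth_series A"
  using star unfolding star_product_def by blast

lemma \<rho>_add: "F \<in> smooth_series A \<Longrightarrow> G \<in> smooth_series A \<Longrightarrow> \<rho> (F + G) = \<rho> F + \<rho> G"
  using state unfolding state_def positive_functional_def by blast

lemma \<rho>_hscale: "F \<in> smooth_series A \<Longrightarrow> \<rho> (hscale a F) = a * \<rho> F"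
  using state unfolding state_def positive_functional_def by blast

lemma \<rho>_1: "\<rho> 1 = 1"
  using state unfolding state_def by blast

lemma \<rho>_diff:
  assumes "F \<in> smooth_series A" "G \<in> smooth_series A"
  shows "\<rho> (F - G) = \<rho> F - \<rho> G"
  using \<rho>_add[OF smooth_series_diff[OF atlas assms] assms(2)] by simp

lemma corr_add:
  assumes "F \<in> smooth_series A" "G \<in> smooth_series A" "H \<in> smooth_series A"
  shows "corr (F + G) H = corr F H + corr G H" "corr H (F + G) = corr H F + corr H G"
proof -
  have "star (F + G) H = star F H + star G H" "star H (F + G) = star H F + star H G"
    using star assms unfolding star_product_def by blast+
  then show "corr (F + G) H = corr F H + corr G H" "corr H (F + G) = corr H F + corr H G"
    using assms by (simp_all add: corr_def \<rho>_add star_smooth)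
qed

lemma corr_hscale:
  assumes "F \<in> smooth_series A" "G \<in> smooth_series A"
  shows "corr (hscale a F) G = a * corr F G" "corr F (hscale a G) = a * corr F G"
proof -
  have "star (hscale a F) G = hscale a (star F G)" "star F (hscale a G) = hscale a (star F G)"
    using star assms unfolding star_product_def by blast+
  then show "corr (hscale a F) G = a * corr F G" "corr F (hscale a G) = a * corr F G"
    using assms by (simp_all add: corr_def \<rho>_hscale star_smooth)
qed

lemma corr_1: "F \<in> smooth_series A \<Longrightarrow> corr 1 F = \<rho> F" "F \<in> smooth_series A \<Longrightarrow> corr F 1 = \<rho> F"
  by (simp_all add: corr_def star_product_unit[OF star])

lemmas corr_simps = corr_add corr_hscale corr_1 \<rho>_add \<rho>_hscale \<rho>_1 smooth_series_1
  smooth_series_add[OF atlas] smooth_series_hscale[OF atlas] observable_smooth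

lemma corr_nonneg: "F \<in> smooth_series A \<Longrightarrow> hnonneg (corr (hcnj F) F)"
  using state unfolding corr_def state_def positive_functional_def by blast

lemma corr_self_nonneg: "observable Y \<Longrightarrow> hnonneg (corr Y Y)"
  using corr_nonneg[of Y] by (simp add: observable_def)

text \<open>This is positivity at \<open>Y + sZ\<close>: since \<open>s\<close> conjugates to \<open>-s\<close>, the two mixed terms combine to
  the commutator, and since \<open>s\<^sup>2 = -1\<close>, the term in \<open>Z * Z\<close> keeps a positive sign.\<close>

lemma corr_commutator_nonneg:
  assumes "observable Y" "observable Z" and s: "s = hconst \<i> \<or> s = - hconst \<i>"
  shows "hnonneg (corr Y Y + corr Z Z + s * (corr Y Z - corr Z Y))"
proof -
  have s2: "s * (s * a) = - a" for a using s hconst_i_square[of a] by auto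
  have cnj_s: "hmap cnj s = - s" using s
    by (auto simp: hahn_eq_iff hcoeff_hmap hcoeff_hmonom)
  have "hcnj (Y + hscale s Z) = Y + hscale (- s) Z"
    using assms(1,2) by (simp add: hcnj_add hcnj_hscale cnj_s observable_def)
  then have "hnonneg (corr (Y + hscale (- s) Z) (Y + hscale s Z))"
    using corr_nonneg[of "Y + hscale s Z"] assms(1,2) by (simp add: corr_simps)
  moreover have "corr (Y + hscale (- s) Z) (Y + hscale s Z)
      = corr Y Y + corr Z Z + s * (corr Y Z - corr Z Y)"
    using assms(1,2) by (simp add: corr_simps s2 algebra_simps)
  ultimately show ?thesis by simp
qed

text \<open>Positivity at \<open>X\<close> and at \<open>X + 1\<close> shows that both expectations are real, and their difference
  is \<open>2 \<rho>(X) + 1\<close>.\<close>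

lemma \<rho>_observable_real:
  assumes "observable X"
  shows "\<rho> X \<in> hreals"
proof -
  have one: "1 \<in> hreals" by (simp add: hreals_iff hcoeff_1)
  have "corr (X + hscale 1 1) (X + hscale 1 1) = corr X X + \<rho> X + \<rho> X + 1"
    using assms by (simp add: corr_simps)
  then have "corr X X + \<rho> X + \<rho> X + 1 \<in> hreals"
    using corr_self_nonneg[OF observable_shift[OF assms one]] by (simp add: hnonneg_iff)
  moreover have "corr X X \<in> hreals" using corr_self_nonneg[OF assms] by (simp add: hnonneg_iff)
  ultimately show ?thesis using one unfolding hreals_iff hcoeff_add plus_complex.sel by simp
qed

definition centred :: "('m \<Rightarrow> complex) hahn \<Rightarrow> ('m \<Rightarrow> complex) hahn" where
  "centred X = X + hscale (- \<rho> X) 1"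

lemma observable_centred: "observable X \<Longrightarrow> observable (centred X)"
  unfolding centred_def
  by (rule observable_shift) (use \<rho>_observable_real in \<open>auto simp: hreals_iff\<close>)

lemma corr_centred:
  assumes "observable X" "observable Z"
  shows "corr (centred X) (centred Z) = corr X Z - \<rho> X * \<rho> Z"
  using assms by (simp add: centred_def corr_simps algebra_simps)

lemma uncertainty_sq_eq: "observable X \<Longrightarrow> uncertainty_sq star \<rho> X = corr (centred X) (centred X)"
  unfolding corr_centred by (simp add: uncertainty_sq_def corr_def power2_eq_square)

lemma uncertainty_sq_nonneg: "observable X \<Longrightarrow> hnonneg (uncertainty_sq star \<rho> X)"
  by (simp add: uncertainty_sq_eq corr_self_nonneg observable_centred)

lemma commutator_eq_bracket:
  assumes "observable X" "observable Z"
  shows "hconst \<i> * (corr X Z - corr Z X) = - (hbar * \<rho> (star_bracket star X Z))"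
proof -
  have "\<rho> (star_bracket star X Z) = 1 / (hconst \<i> * hbar) * (corr X Z - corr Z X)"
    using assms
    by (simp add: star_bracket_def \<rho>_hscale \<rho>_diff star_smooth smooth_series_diff[OF atlas]
        corr_def observable_smooth)
  moreover have "hconst \<i> * hbar \<noteq> (0 :: complex hahn)"
    by (auto simp: hmonom_mult_hmonom hahn_nonzero hcoeff_hmonom)
  ultimately have "corr X Z - corr Z X = hconst \<i> * (hbar * \<rho> (star_bracket star X Z))"
    by (simp add: field_simps)
  then show ?thesis by (simp only: hconst_i_square)
qed

lemma pair_nonneg:
  assumes X: "observable X" and Z: "observable Z"
  shows "hnonneg (uncertainty_sq star \<rho> X + uncertainty_sq star \<rho> Z
      + hbar * \<rho> (star_bracket star X Z))"
    and "hnonneg (uncertainty_sq star \<rho> X + uncertainty_sq star \<rho> Z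
      - hbar * \<rho> (star_bracket star X Z))"
proof -
  have "corr (centred X) (centred Z) - corr (centred Z) (centred X) = corr X Z - corr Z X"
    using assms by (simp add: corr_centred)
  then show "hnonneg (uncertainty_sq star \<rho> X + uncertainty_sq star \<rho> Z
      + hbar * \<rho> (star_bracket star X Z))"
    "hnonneg (uncertainty_sq star \<rho> X + uncertainty_sq star \<rho> Z
      - hbar * \<rho> (star_bracket star X Z))"
    using corr_commutator_nonneg[OF observable_centred[OF X] observable_centred[OF Z],
        of "- hconst \<i>"]
      corr_commutator_nonneg[OF observable_centred[OF X] observable_centred[OF Z],
        of "hconst \<i>"] assms
    by (simp_all add: uncertainty_sq_eq commutator_eq_bracket)
qed

lemma bracket_real:
  assumes "observable X" "observable Z"
  shows "\<rho> (star_bracket star X Z) \<in> hreals"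
proof -
  let ?w = "\<rho> (star_bracket star X Z)"
  have "hbar * ?w \<in> hreals"
    using pair_nonneg(1)[OF assms] uncertainty_sq_nonneg[OF assms(1)]
      uncertainty_sq_nonneg[OF assms(2)]
    by (auto simp: hnonneg_iff hreals_iff)
  then have "Im (hcoeff (hbar * ?w) (q + 1)) = 0" for q by (simp add: hreals_iff)
  then show ?thesis by (simp add: hreals_iff hcoeff_hmonom_mult)
qed

lemma pair_uncertainty:
  assumes "observable X" "observable Z"
  shows "hbar * \<bar>hRe (\<rho> (star_bracket star X Z))\<bar>
    \<le> hRe (uncertainty_sq star \<rho> X) + hRe (uncertainty_sq star \<rho> Z)"
proof -
  have "hbar * \<bar>hRe (\<rho> (star_bracket star X Z))\<bar> = \<bar>hRe (hbar * \<rho> (star_bracket star X Z))\<bar>"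
    using hbar_pos by (simp add: hRe_hbar_mult abs_mult)
  also have "\<dots> \<le> hRe (uncertainty_sq star \<rho> X) + hRe (uncertainty_sq star \<rho> Z)"
    using pair_nonneg[OF assms]
    unfolding hnonneg_iff diff_conv_add_uminus hRe_add hRe_uminus by (simp add: abs_le_iff)
  finally show ?thesis .
qed

end


section \<open>Summation over pairs\<close>

text \<open>Each index lies in \<open>m\<close> of the pairs; passing from \<open>m\<close> to \<open>m + 1\<close> adds the pairs
  \<open>(j, m + 2)\<close> with \<open>j \<le> m + 1\<close>.\<close>

lemma sum_pairs:
  fixes D :: "nat \<Rightarrow> 'a::comm_ring_1"
  shows "(\<Sum>(j, k)\<in>{(j, k). 1 \<le> j \<and> j < k \<and> k \<le> Suc m}. D j + D k)
    = of_nat m * (\<Sum>j=1..Suc m. D j)"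
proof (induction m)
  case 0
  have "{(j, k). 1 \<le> j \<and> j < k \<and> k \<le> Suc 0} = {}" by auto
  then show ?case by (simp only:) simp
next
  case (Suc m)
  let ?P = "\<lambda>m. {(j, k). 1 \<le> j \<and> j < k \<and> k \<le> Suc m}"
  let ?N = "(\<lambda>j. (j, Suc (Suc m))) ` {1..Suc m}"
  have "?P (Suc m) = ?P m \<union> ?N" by auto
  moreover have "finite (?P m)"
    by (rule finite_subset[of _ "{..Suc m} \<times> {..Suc m}"]) auto
  moreover have "?P m \<inter> ?N = {}" by auto
  ultimately have "(\<Sum>(j, k)\<in>?P (Suc m). D j + D k)
      = (\<Sum>(j, k)\<in>?P m. D j + D k) + (\<Sum>(j, k)\<in>?N. D j + D k)"
    by (simp only:) (rule sum.union_disjoint, auto)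
  also have "(\<Sum>(j, k)\<in>?N. D j + D k)
      = (\<Sum>j=1..Suc m. D j) + of_nat (Suc m) * D (Suc (Suc m))"
    by (subst sum.reindex) (auto simp: inj_on_def sum.distrib)
  finally show ?case unfolding Suc.IH by (simp add: algebra_simps)
qed

theorem mainTheorem5:
  fixes A :: "('m::{t2_space,second_countable_topology}, 'e::real_normed_vector) chart set"
    and \<omega> :: "'m \<Rightarrow> 'm tvec \<Rightarrow> 'm tvec \<Rightarrow> real"
    and star :: "('m \<Rightarrow> complex) hahn \<Rightarrow> ('m \<Rightarrow> complex) hahn \<Rightarrow> ('m \<Rightarrow> complex) hahn"
    and \<rho> :: "('m \<Rightarrow> complex) hahn \<Rightarrow> complex hahn"
    and n :: nat
    and X :: "nat \<Rightarrow> ('m \<Rightarrow> complex) hahn"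
  assumes "symplectic_manifold A \<omega>"
    and "star_product A \<omega> star"
    and "state A star \<rho>"
    and "n \<ge> 2"
    and "\<And>j. j \<in> {1..n} \<Longrightarrow> X j \<in> smooth_series A"
    and "\<And>j. j \<in> {1..n} \<Longrightarrow> hcnj (X j) = X j"
  shows "(\<forall>j\<in>{1..n}. uncertainty_sq star \<rho> (X j) \<in> hreals)
    \<and> (\<forall>j k. 1 \<le> j \<and> j < k \<and> k \<le> n \<longrightarrow> \<rho> (star_bracket star (X j) (X k)) \<in> hreals)
    \<and> (\<Sum>j=1..n. hRe (uncertainty_sq star \<rho> (X j)))
        \<ge> hbar / of_nat (n - 1) *
          (\<Sum>(j, k)\<in>{(j, k). 1 \<le> j \<and> j < k \<and> k \<le> n}. \<bar>hRe (\<rho> (star_bracket star (X j) (X k)))\<bar>)"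
proof -
  interpret star_state A \<omega> star \<rho>
    by unfold_locales (use assms(1-3) in \<open>auto simp: symplectic_manifold_def\<close>)
  have obs: "observable (X j)" if "1 \<le> j" "j \<le> n" for j
    using assms(5,6)[of j] that by (simp add: observable_def)
  define D where "D j = hRe (uncertainty_sq star \<rho> (X j))" for j
  define B where "B j k = \<bar>hRe (\<rho> (star_bracket star (X j) (X k)))\<bar>" for j k
  let ?P = "{(j, k). 1 \<le> j \<and> j < k \<and> k \<le> n}"
  have "hbar * (\<Sum>(j, k)\<in>?P. B j k) = (\<Sum>(j, k)\<in>?P. hbar * B j k)"
    by (simp add: sum_distrib_left case_prod_beta)
  also have "\<dots> \<le> (\<Sum>(j, k)\<in>?P. D j + D k)"
    by (rule sum_mono) (auto simp: B_def D_def intro!: pair_uncertainty obs)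
  also have "\<dots> = of_nat (n - 1) * (\<Sum>j=1..n. D j)"
    using sum_pairs[where m = "n - 1" and D = D] assms(4) by simp
  finally have "hbar / of_nat (n - 1) * (\<Sum>(j, k)\<in>?P. B j k) \<le> (\<Sum>j=1..n. D j)"
    using assms(4) by (simp add: field_simps)
  then show ?thesis
    using uncertainty_sq_nonneg bracket_real obs
    by (auto simp: B_def D_def hnonneg_iff)
qed

end
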